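(* Let $\mathcal{H}$ be a $d$-dimensional complex Hilbert space, let $\mathbb{B}=\{\mathcal{B}_1,\ldots,\mathcal{B}_M\}$ be a set of $M\ge 1$ mutually unbiased bases in $\mathcal{H}$, let $\alpha\in(0,2]$, $\eta\in[0,1]$, and let $\rho$ be an arbitrary density matrix on $\mathcal{H}$. Then $$\frac{1}{M}\sum_{\mathcal{B}\in\mathbb{B}}H_\alpha^{(\eta)}(\mathcal{B}|\rho)\;\ge\;\eta^\alpha\,\ln_\alpha\!\left(\frac{Md}{\mathrm{tr}(\rho^2)\,d+M-1}\right)+h_\alpha(\eta).$$
   Context: A density matrix on $\mathcal{H}$ is a positive semidefinite operator of trace $1$. Orthonormal bases $\{|b_j\rangle\}$ and $\{|c_k\rangle\}$ of $\mathcal{H}$ are mutually unbiased if $|\langle b_j|c_k\rangle|=1/\sqrt d$ for all $j,k$; a set of bases is a set of mutually unbiased bases (MUBs) if any two different bases in it are mutually unbiased. For $x>0$ and $\alpha>0$, $\alpha\ne1$, $\ln_\alpha(x)=\frac{x^{1-\alpha}-1}{1-\alpha}$, and $\ln_1(x)=\ln x$. For a probability distribution $p=\{p_j\}$, the Tsallis $\alpha$-entropy is $H_\alpha(p)=\frac{1}{1-\alpha}\bigl(\sum_j p_j^\alpha-1\bigr)$ for $\alpha>0$, $\alpha\neq 1$, and $H_1(p)=-\sum_j p_j\ln p_j$ (with $0\ln 0=0$). The binary Tsallis entropy is $h_\alpha(\eta)=-\eta^\alpha\ln_\alpha(\eta)-(1-\eta)^\alpha\ln_\alpha(1-\eta)$,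 i.e. $H_\alpha$ of the two-point distribution $(\eta,1-\eta)$ (terms with argument $0$ are taken to be $0$). Model of detection inefficiency: for an orthonormal basis $\mathcal{B}=\{|b_j\rangle\}_{j=1}^d$ and $\eta\in[0,1]$, $H_\alpha^{(\eta)}(\mathcal{B}|\rho)$ denotes $H_\alpha$ of the distribution on $d+1$ outcomes $p_j^{(\eta)}=\eta\,\langle b_j|\rho|b_j\rangle$ ($j=1,\ldots,d$), $p_\varnothing^{(\eta)}=1-\eta$. *)

theory Defs
  imports "HOL-Analysis.Analysis"
begin

text \<open>The \<open>d\<close>-dimensional complex Hilbert space is \<open>complex ^ 'd\<close> with \<open>d = CARD('d)\<close>; operators
  are square matrices over it. The inner product is antilinear in the first argument (bra-ket
  convention). It is defined here because the library's \<open>\<bullet>\<close> on this type is its real part.\<close>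

definition cinner :: "complex ^ 'd \<Rightarrow> complex ^ 'd \<Rightarrow> complex" where
  "cinner x y = (\<Sum>i\<in>UNIV. cnj (x $ i) * y $ i)"

definition hermitian :: "complex ^ 'd ^ 'd \<Rightarrow> bool" where
  "hermitian A \<longleftrightarrow> (\<forall>x y. cinner (A *v x) y = cinner x (A *v y))"

definition positive_semidefinite :: "complex ^ 'd ^ 'd \<Rightarrow> bool" where
  "positive_semidefinite A \<longleftrightarrow> hermitian A \<and> (\<forall>x. 0 \<le> Re (cinner x (A *v x)))"

definition density_matrix :: "complex ^ 'd ^ 'd \<Rightarrow> bool" where
  "density_matrix \<rho> \<longleftrightarrow> positive_semidefinite \<rho> \<and> trace \<rho> = 1"

text \<open>\<open>vec.span\<close> is the span over the complex scalars.\<close>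

definition orthonormal_basis :: "('d \<Rightarrow> complex ^ 'd) \<Rightarrow> bool" where
  "orthonormal_basis b \<longleftrightarrow>
    (\<forall>j k. cinner (b j) (b k) = (if j = k then 1 else 0)) \<and> vec.span (range b) = UNIV"

definition mutually_unbiased :: "('d \<Rightarrow> complex ^ 'd) \<Rightarrow> ('d \<Rightarrow> complex ^ 'd) \<Rightarrow> bool" where
  "mutually_unbiased b c \<longleftrightarrow> (\<forall>j k. cmod (cinner (b j) (c k)) = 1 / sqrt (real CARD('d)))"

definition MUBs :: "('d \<Rightarrow> complex ^ 'd) set \<Rightarrow> bool" where
  "MUBs \<B> \<longleftrightarrow> (\<forall>b\<in>\<B>. orthonormal_basis b) \<and>
    (\<forall>b\<in>\<B>. \<forall>c\<in>\<B>. b \<noteq> c \<longrightarrow> mutually_unbiased b c)"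

definition ln_tsallis :: "real \<Rightarrow> real \<Rightarrow> real" where
  "ln_tsallis \<alpha> x = (if \<alpha> = 1 then ln x else (x powr (1 - \<alpha>) - 1) / (1 - \<alpha>))"

text \<open>In the entropies below, terms with argument \<open>0\<close> vanish as required, because
  \<open>0 powr \<alpha> = 0\<close> and \<open>0 * ln 0 = 0\<close>.\<close>

definition tsallis_entropy :: "real \<Rightarrow> ('k::finite \<Rightarrow> real) \<Rightarrow> real" where
  "tsallis_entropy \<alpha> p =
    (if \<alpha> = 1 then - (\<Sum>j\<in>UNIV. p j * ln (p j))
     else 1 / (1 - \<alpha>) * ((\<Sum>j\<in>UNIV. p j powr \<alpha>) - 1))"

definition binary_tsallis_entropy :: "real \<Rightarrow> real \<Rightarrow> real" where
  "binary_tsallis_entropy \<alpha> \<eta> =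
    - (\<eta> powr \<alpha>) * ln_tsallis \<alpha> \<eta> - (1 - \<eta>) powr \<alpha> * ln_tsallis \<alpha> (1 - \<eta>)"

text \<open>The outcome \<open>None\<close> is the no-click event. The diagonal entries of a density matrix in an
  orthonormal basis are real, so taking \<open>Re\<close> loses nothing.\<close>

definition detection_distribution ::
    "real \<Rightarrow> ('d \<Rightarrow> complex ^ 'd) \<Rightarrow> complex ^ 'd ^ 'd \<Rightarrow> 'd option \<Rightarrow> real" where
  "detection_distribution \<eta> b \<rho> k =
    (case k of None \<Rightarrow> 1 - \<eta> | Some j \<Rightarrow> \<eta> * Re (cinner (b j) (\<rho> *v b j)))"

definition inefficient_entropy ::
    "real \<Rightarrow> real \<Rightarrow> ('d \<Rightarrow> complex ^ 'd) \<Rightarrow> complex ^ 'd ^ 'd \<Rightarrow> real" where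
  "inefficient_entropy \<alpha> \<eta> b \<rho> = tsallis_entropy \<alpha> (detection_distribution \<eta> b \<rho>)"

end

theory Submission
  imports Defs
begin

text \<open>With \<open>f x = ln_tsallis \<alpha> (1 / x)\<close>, the Tsallis entropy is \<open>\<Sum> p\<^sub>j * f p\<^sub>j\<close>, and \<open>f\<close> is convex
  and decreasing for \<open>\<alpha> \<le> 2\<close>. Bounding \<open>f\<close> below by its tangent therefore bounds the average entropy
  below in terms of the index of coincidence \<open>\<Sum> p\<^sub>j\<^sup>2\<close>. The latter is controlled by Bessel's
  inequality in the space of matrices: after subtracting \<open>1 / d\<close> times the identity, the projectors of
  different mutually unbiased bases become orthogonal. Detection inefficiency only rescales the entropy
  by \<open>\<eta> powr \<alpha>\<close> and adds the binary entropy.\<close>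

section \<open>Tsallis entropy\<close>

text \<open>The second derivative of \<open>ln_tsallis \<alpha> (1 / x)\<close> is
  \<open>(2 - \<alpha>) * x powr (\<alpha> - 3)\<close>, nonnegative because \<alpha> \<le> 2. The
  point of tangency \<open>c\<close> stays free, so that one tangent can later serve all bases at
  once.\<close>

lemma ln_tsallis_inverse_above_tangent:
  assumes "\<alpha> \<le> 2" "x > 0" "c > 0"
  shows "ln_tsallis \<alpha> (1 / x) \<ge> ln_tsallis \<alpha> (1 / c) + c powr (\<alpha> - 2) * (c - x)"
proof -
  let ?f = "\<lambda>x. ln_tsallis \<alpha> (1 / x)"
  have f: "?f y = (if \<alpha> = 1 then - ln y else (y powr (\<alpha> - 1) - 1) / (1 - \<alpha>))" if "y > 0" for y
    using that by (simp add: ln_tsallis_def ln_div powr_divide powr_minus_divide powr_diff)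
  have d1: "(?f has_real_derivative - (y powr (\<alpha> - 2))) (at y)" if "y > 0" for y
  proof -
    have "((\<lambda>y. if \<alpha> = 1 then - ln y else (y powr (\<alpha> - 1) - 1) / (1 - \<alpha>))
        has_real_derivative - (y powr (\<alpha> - 2))) (at y)"
    proof (cases "\<alpha> = 1")
      case True
      have "((\<lambda>y. - ln y) has_real_derivative - (1 / y)) (at y)"
        using that by (intro DERIV_minus DERIV_ln_divide)
      then show ?thesis
        using True that powr_neg_one[of y] by simp
    next
      case False
      have "((\<lambda>y. (y powr (\<alpha> - 1) - 1) / (1 - \<alpha>))
          has_real_derivative ((\<alpha> - 1) * y powr (\<alpha> - 1 - 1)) / (1 - \<alpha>)) (at y)"
        using that False by (auto intro!: derivative_eq_intros)
      moreover have "((\<alpha> - 1) * y powr (\<alpha> - 1 - 1)) / (1 - \<alpha>) = - (y powr (\<alpha> - 2))"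
        using False by (simp add: field_simps)
      ultimately show ?thesis using False by simp
    qed
    \<comment> \<open>The closed form \<open>f\<close> holds only for positive arguments, so the
      derivative is carried over on the open half-line.\<close>
    then show ?thesis
      by (rule has_field_derivative_transform_within_open[of _ _ _ "{0<..}"])
        (use that f in auto)
  qed
  have d2: "((\<lambda>y. - (y powr (\<alpha> - 2))) has_real_derivative (2 - \<alpha>) * y powr (\<alpha> - 3)) (at y)"
    if "y > 0" for y
    using that by (auto intro!: derivative_eq_intros simp: algebra_simps)
  have conv: "convex_on {0<..} ?f"
    using assms(1) by (intro f''_ge0_imp_convex[OF _ d1 d2]) auto
  have "?f x - ?f c \<ge> - (c powr (\<alpha> - 2)) * (x - c)"
    using assms d1[of c]
    by (intro convex_on_imp_above_tangent[OF conv]) (auto simp: interior_open has_field_derivative_at_within)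
  then show ?thesis by (simp add: algebra_simps)
qed

text \<open>For \<alpha> other than 1, normalisation absorbs the constant: the 1 being subtracted is
  split into the \<open>p j\<close>. Where \<open>p j = 0\<close>, the factor \<open>p j\<close>
  removes the junk value of \<open>1 / p j\<close>.\<close>

lemma tsallis_entropy_altdef:
  assumes "\<And>j. p j \<ge> 0" "sum p UNIV = 1"
  shows "tsallis_entropy \<alpha> p = (\<Sum>j\<in>UNIV. p j * ln_tsallis \<alpha> (1 / p j))"
proof (cases "\<alpha> = 1")
  case True
  have "p j * ln (1 / p j) = - (p j * ln (p j))" for j
    using assms(1)[of j] by (cases "p j = 0") (auto simp: ln_div)
  then show ?thesis
    using True by (simp add: tsallis_entropy_def ln_tsallis_def sum_negf)
next
  case False
  have "p j * ln_tsallis \<alpha> (1 / p j) = (p j powr \<alpha> - p j) / (1 - \<alpha>)" for j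
    using assms(1)[of j] False
    by (cases "p j = 0") (auto simp: ln_tsallis_def powr_divide powr_diff field_simps)
  then show ?thesis
    using False assms(2)
    by (simp add: tsallis_entropy_def sum_subtractf flip: sum_divide_distrib)
qed

text \<open>The tangent bound is averaged with weights \<open>p j\<close>, which turns its linear
  term into \<open>c\<close> minus the index of coincidence.\<close>

lemma tsallis_entropy_ge:
  assumes "\<alpha> \<le> 2" "c > 0" and p: "\<And>j. p j \<ge> 0" "sum p UNIV = 1"
  shows "tsallis_entropy \<alpha> p \<ge> ln_tsallis \<alpha> (1 / c) + c powr (\<alpha> - 2) * (c - (\<Sum>j\<in>UNIV. (p j)\<^sup>2))"
proof -
  let ?L = "ln_tsallis \<alpha> (1 / c)" and ?K = "c powr (\<alpha> - 2)"
  have "?L + ?K * (c - (\<Sum>j\<in>UNIV. (p j)\<^sup>2)) = (\<Sum>j\<in>UNIV. p j * (?L + ?K * (c - p j)))"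
  proof -
    have "p j * (?L + ?K * (c - p j)) = (?L + ?K * c) * p j - ?K * (p j)\<^sup>2" for j
      by (simp add: algebra_simps power2_eq_square)
    then have "(\<Sum>j\<in>UNIV. p j * (?L + ?K * (c - p j)))
        = (?L + ?K * c) * sum p UNIV - ?K * (\<Sum>j\<in>UNIV. (p j)\<^sup>2)"
      by (simp only: sum_subtractf sum_distrib_left)
    then show ?thesis
      using p(2) by (simp add: algebra_simps)
  qed
  also have "\<dots> \<le> (\<Sum>j\<in>UNIV. p j * ln_tsallis \<alpha> (1 / p j))"
  proof (rule sum_mono)
    fix j
    \<comment> \<open>The tangent bound needs a positive argument; for \<open>p j = 0\<close> both
      sides vanish.\<close>
    show "p j * (?L + ?K * (c - p j)) \<le> p j * ln_tsallis \<alpha> (1 / p j)"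
      using ln_tsallis_inverse_above_tangent[OF assms(1) _ assms(2), of "p j"] p(1)[of j]
      by (cases "p j = 0") (auto intro!: mult_left_mono)
  qed
  finally show ?thesis using tsallis_entropy_altdef[OF p] by simp
qed

text \<open>The grouping rule of entropy: the click event, of probability \<eta>, is refined by
  \<open>p\<close>, and the refinement contributes its own entropy with weight
  \<open>\<eta> powr \<alpha>\<close>.\<close>

lemma tsallis_entropy_inefficient:
  fixes p :: "'k::finite \<Rightarrow> real"
  assumes p: "\<And>j. p j \<ge> 0" "sum p UNIV = 1" and \<eta>: "0 \<le> \<eta>" "\<eta> \<le> 1"
  shows "tsallis_entropy \<alpha> (case_option (1 - \<eta>) (\<lambda>j. \<eta> * p j))
    = \<eta> powr \<alpha> * tsallis_entropy \<alpha> p + binary_tsallis_entropy \<alpha> \<eta>"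
proof -
  have sum_option: "(\<Sum>k\<in>UNIV. g k) = g None + (\<Sum>j\<in>UNIV. g (Some j))" for g :: "'k option \<Rightarrow> real"
    by (simp add: UNIV_option_conv sum.reindex)
  show ?thesis
  proof (cases "\<alpha> = 1")
    case True
    have "\<eta> * p j * ln (\<eta> * p j) = \<eta> * (p j * ln (p j)) + \<eta> * ln \<eta> * p j" for j
      using p(1)[of j] \<eta> by (cases "p j = 0"; cases "\<eta> = 0") (auto simp: ln_mult algebra_simps)
    then have "(\<Sum>j\<in>UNIV. \<eta> * p j * ln (\<eta> * p j)) = \<eta> * (\<Sum>j\<in>UNIV. p j * ln (p j)) + \<eta> * ln \<eta>"
      using p(2) by (simp add: sum.distrib flip: sum_distrib_left)
    then show ?thesis
      using True \<eta>
      by (simp add: tsallis_entropy_def binary_tsallis_entropy_def ln_tsallis_def sum_option)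
  next
    case False
    \<comment> \<open>In the binary entropy the linear parts \<eta> and \<open>1 - \<eta>\<close>
      then add up to the 1 subtracted in \<open>tsallis_entropy\<close>.\<close>
    have *: "x powr \<alpha> * ln_tsallis \<alpha> x = (x - x powr \<alpha>) / (1 - \<alpha>)" if "x \<ge> 0" for x
      using that False by (cases "x = 0") (auto simp: ln_tsallis_def powr_diff field_simps)
    have "(\<Sum>j\<in>UNIV. (\<eta> * p j) powr \<alpha>) = \<eta> powr \<alpha> * (\<Sum>j\<in>UNIV. p j powr \<alpha>)"
      using p(1) \<eta> by (simp add: powr_mult sum_distrib_left)
    then show ?thesis
      using False \<eta> *[of \<eta>] *[of "1 - \<eta>"]
      by (simp add: tsallis_entropy_def binary_tsallis_entropy_def sum_option field_simps)
  qed
qed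

section \<open>The index of coincidence\<close>

text \<open>The operator |v><v|, a rank-one projector when \<open>v\<close> is a unit
  vector.\<close>

definition outer :: "complex ^ 'd \<Rightarrow> complex ^ 'd ^ 'd" where
  "outer v = (\<chi> i k. v $ i * cnj (v $ k))"

lemma inner_complex_eq: "inner z w = Re (z * cnj w)"
  by (simp add: inner_complex_def)

text \<open>The library's real inner product on \<open>complex ^ 'd ^ 'd\<close> is the real part of the
  Hilbert-Schmidt inner product.\<close>

lemma inner_matrix_eq:
  fixes A B :: "complex ^ 'd ^ 'd"
  shows "inner A B = Re (\<Sum>i\<in>UNIV. \<Sum>k\<in>UNIV. A $ i $ k * cnj (B $ i $ k))"
  by (simp add: inner_vec_def inner_complex_eq)

text \<open>Makes outcome probabilities into coordinates in the real Euclidean space of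
  matrices.\<close>

lemma inner_outer:
  fixes A :: "complex ^ 'd ^ 'd"
  shows "inner A (outer v) = Re (cinner v (A *v v))"
  by (simp add: inner_matrix_eq outer_def cinner_def matrix_vector_mult_def sum_distrib_left ac_simps)

lemma outer_mult_vec: "outer w *v v = (\<chi> i. w $ i * cinner w v)"
  by (simp add: vec_eq_iff outer_def cinner_def matrix_vector_mult_def sum_distrib_left ac_simps)

lemma cinner_commute: "cinner v w = cnj (cinner w v)"
  by (simp add: cinner_def ac_simps)

lemma inner_outer_outer: "inner (outer w) (outer v) = (cmod (cinner v w))\<^sup>2"
proof -
  have "cinner v (outer w *v v) = cinner v w * cinner w v"
    unfolding outer_mult_vec by (simp add: cinner_def[of v] sum_distrib_right mult.assoc)
  then have "cinner v (outer w *v v) = cinner v w * cnj (cinner v w)"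
    using cinner_commute[of w v] by simp
  then show ?thesis
    by (simp add: inner_outer complex_mult_cnj cmod_power2)
qed

lemma inner_mat_1:
  fixes A :: "complex ^ 'd ^ 'd"
  shows "inner A (mat 1) = Re (trace A)"
  by (simp add: inner_matrix_eq mat_def trace_def if_distrib cong: if_cong)

text \<open>Hermiticity is tested on the standard basis vectors, which read off single
  entries.\<close>

lemma hermitian_entry:
  fixes A :: "complex ^ 'd::finite ^ 'd"
  assumes "hermitian A"
  shows "cnj (A $ i $ k) = A $ k $ i"
proof -
  have col: "(A *v axis j 1) $ l = A $ l $ j" for j l
    by (simp add: matrix_vector_mult_def axis_def if_distrib cong: if_cong)
  have ax: "cinner (axis j 1) y = y $ j" for j and y :: "complex ^ 'd"
    by (simp add: cinner_def axis_def if_distrib if_distribR cong: if_cong)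
  have "cinner (A *v axis k 1) (axis i 1) = cinner (axis k 1) (A *v axis i 1)"
    using assms by (simp add: hermitian_def)
  then show ?thesis
    by (simp add: ax col cinner_commute[of _ "axis i 1"])
qed

lemma hermitian_inner_self:
  assumes "hermitian A"
  shows "inner A A = Re (trace (A ** A))"
  by (simp add: inner_matrix_eq trace_def matrix_matrix_mult_def hermitian_entry[OF assms])

text \<open>Orthonormality says that the matrix with columns \<open>b j\<close> has its conjugate
  transpose as left inverse. For square matrices this is also a right inverse, which is the
  resolution of the identity.\<close>

lemma orthonormal_basis_sum_outer:
  fixes b :: "'d::finite \<Rightarrow> complex ^ 'd"
  assumes "orthonormal_basis b"
  shows "(\<Sum>j\<in>UNIV. outer (b j)) = mat 1"
proof -
  define U :: "complex ^ 'd ^ 'd" where "U = (\<chi> j i. cnj (b j $ i))"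
  define V :: "complex ^ 'd ^ 'd" where "V = (\<chi> i j. b j $ i)"
  have "U ** V = mat 1"
    using assms
    by (auto simp: U_def V_def vec_eq_iff matrix_matrix_mult_def mat_def orthonormal_basis_def cinner_def)
  then have "V ** U = mat 1"
    by (simp add: matrix_left_right_inverse)
  moreover have "V ** U = (\<Sum>j\<in>UNIV. outer (b j))"
    by (simp add: U_def V_def vec_eq_iff matrix_matrix_mult_def outer_def)
  ultimately show ?thesis by simp
qed

lemma orthonormal_basis_sum_diagonal:
  fixes A :: "complex ^ 'd::finite ^ 'd"
  assumes "orthonormal_basis b"
  shows "(\<Sum>j\<in>UNIV. Re (cinner (b j) (A *v b j))) = Re (trace A)"
  using orthonormal_basis_sum_outer[OF assms]
  by (simp add: inner_mat_1 flip: inner_outer inner_sum_right)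

text \<open>\<open>R\<close> is the traceless part of \<rho>, and \<open>S b\<close> is its
  orthogonal projection onto the span of the projectors of \<open>b\<close>. The \<open>S b\<close>
  are pairwise orthogonal, so their squared norms add up to at most that of
  \<open>R\<close>.\<close>

lemma MUBs_sum_diagonal_squares_le:
  fixes \<rho> :: "complex ^ 'd::finite ^ 'd"
  assumes mub: "MUBs \<B>" and fin: "finite \<B>" and herm: "hermitian \<rho>" and tr: "trace \<rho> = 1"
  shows "(\<Sum>b\<in>\<B>. \<Sum>j\<in>UNIV. (Re (cinner (b j) (\<rho> *v b j)))\<^sup>2)
    \<le> Re (trace (\<rho> ** \<rho>)) + (real (card \<B>) - 1) / real CARD('d)"
proof -
  define d where "d = real CARD('d)"
  have d: "d > 0" by (simp add: d_def)
  define p where "p b j = Re (cinner (b j) (\<rho> *v b j))" for b and j :: 'd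
  define x where "x b j = p b j - 1 / d" for b j
  define R where "R = \<rho> - (1 / d) *\<^sub>R mat 1"
  define S where "S b = (\<Sum>j\<in>UNIV. x b j *\<^sub>R outer (b j))" for b
  have onb: "orthonormal_basis b" if "b \<in> \<B>" for b
    using mub that by (simp add: MUBs_def)
  have p_sum: "(\<Sum>j\<in>UNIV. p b j) = 1" if "b \<in> \<B>" for b
    using orthonormal_basis_sum_diagonal[OF onb[OF that], of \<rho>] tr by (simp add: p_def)
  have x_sum: "(\<Sum>j\<in>UNIV. x b j) = 0" if "b \<in> \<B>" for b
    using p_sum[OF that] d by (simp add: x_def sum_subtractf d_def)
  have RS: "inner R (S b) = (\<Sum>j\<in>UNIV. (x b j)\<^sup>2)" if "b \<in> \<B>" for b
  proof -
    have "inner R (outer (b j)) = x b j" for j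
    proof -
      have "inner (mat 1) (outer (b j)) = 1"
        using onb[OF that] by (simp add: inner_outer orthonormal_basis_def)
      then show ?thesis
        unfolding R_def inner_diff_left inner_scaleR_left by (simp add: inner_outer x_def p_def)
    qed
    then show ?thesis
      by (simp add: S_def inner_sum_right power2_eq_square)
  qed
  have SS_expand: "inner (S b) (S c)
      = (\<Sum>j\<in>UNIV. \<Sum>k\<in>UNIV. x b j * x c k * (cmod (cinner (c k) (b j)))\<^sup>2)" for b c
    unfolding S_def inner_sum_left
    by (simp add: inner_sum_right inner_outer_outer sum_distrib_left mult.assoc mult.left_commute)
  have SS_eq: "inner (S b) (S b) = (\<Sum>j\<in>UNIV. (x b j)\<^sup>2)" if "b \<in> \<B>" for b
  proof -
    have "x b j * x b k * (cmod (cinner (b k) (b j)))\<^sup>2 = (if j = k then (x b j)\<^sup>2 else 0)" for j k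
      using onb[OF that] by (auto simp: orthonormal_basis_def power2_eq_square)
    then show ?thesis unfolding SS_expand by simp
  qed
  \<comment> \<open>All overlaps equal \<open>1 / d\<close>, so the double sum factors into two
    coefficient sums, which are zero.\<close>
  have SS_neq: "inner (S b) (S c) = 0" if "b \<in> \<B>" "c \<in> \<B>" "b \<noteq> c" for b c
  proof -
    have "(cmod (cinner (c k) (b j)))\<^sup>2 = 1 / d" for j k
      using mub that by (simp add: MUBs_def mutually_unbiased_def d_def power_divide)
    then have "inner (S b) (S c) = (\<Sum>j\<in>UNIV. x b j) * (\<Sum>k\<in>UNIV. x c k) / d"
      unfolding SS_expand by (simp add: sum_product sum_divide_distrib)
    then show ?thesis using x_sum[OF that(1)] by simp
  qed
  let ?X = "\<Sum>b\<in>\<B>. \<Sum>j\<in>UNIV. (x b j)\<^sup>2" and ?S = "\<Sum>b\<in>\<B>. S b"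
  \<comment> \<open>Since \<open>inner R ?S\<close> and \<open>inner ?S ?S\<close> agree, the
    squared norm of \<open>R - ?S\<close> is \<open>inner R R - ?X\<close>.\<close>
  have "inner R ?S = ?X"
    by (simp add: inner_sum_right RS)
  moreover have "inner ?S ?S = ?X"
  proof -
    have "inner ?S ?S = (\<Sum>b\<in>\<B>. \<Sum>c\<in>\<B>. inner (S b) (S c))"
      by (simp add: inner_sum_left inner_sum_right inner_commute)
    also have "\<dots> = (\<Sum>b\<in>\<B>. \<Sum>c\<in>\<B>. if b = c then \<Sum>j\<in>UNIV. (x b j)\<^sup>2 else 0)"
      by (intro sum.cong refl) (auto simp: SS_eq SS_neq)
    finally show ?thesis using fin by simp
  qed
  moreover have "0 \<le> inner (R - ?S) (R - ?S)" by simp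
  ultimately have "?X \<le> inner R R"
    by (simp add: inner_diff_left inner_diff_right inner_commute)
  also have "inner R R = Re (trace (\<rho> ** \<rho>)) - 1 / d"
  proof -
    have "inner (mat 1 :: complex ^ 'd ^ 'd) (mat 1) = d"
      unfolding inner_mat_1 by (simp add: trace_def mat_def d_def)
    moreover have "inner \<rho> (mat 1) = 1" "inner (mat 1) \<rho> = 1"
      by (simp_all add: inner_mat_1 tr inner_commute[of _ \<rho>])
    ultimately show ?thesis
      using d hermitian_inner_self[OF herm]
      by (simp add: R_def inner_diff_left inner_diff_right)
  qed
  finally have X_le: "?X \<le> Re (trace (\<rho> ** \<rho>)) - 1 / d" .
  have "(\<Sum>j\<in>UNIV. (x b j)\<^sup>2) = (\<Sum>j\<in>UNIV. (p b j)\<^sup>2) - 1 / d" if "b \<in> \<B>" for b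
  proof -
    have "(x b j)\<^sup>2 = (p b j)\<^sup>2 - 2 / d * p b j + 1 / d\<^sup>2" for j
      by (simp add: x_def power2_diff power_divide)
    then have "(\<Sum>j\<in>UNIV. (x b j)\<^sup>2) = (\<Sum>j\<in>UNIV. (p b j)\<^sup>2) - 2 / d + d * (1 / d\<^sup>2)"
      using p_sum[OF that]
      by (simp add: sum.distrib sum_subtractf d_def flip: sum_distrib_left sum_divide_distrib)
    then show ?thesis using d by (simp add: power2_eq_square field_simps)
  qed
  then have "?X = (\<Sum>b\<in>\<B>. \<Sum>j\<in>UNIV. (p b j)\<^sup>2) - real (card \<B>) / d"
    by (simp add: sum_subtractf)
  with X_le show ?thesis
    by (simp add: p_def d_def diff_divide_distrib)
qed

theorem mainTheorem2:
  fixes \<B> :: "('d::finite \<Rightarrow> complex ^ 'd) set"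
    and \<rho> :: "complex ^ 'd ^ 'd"
    and \<alpha> \<eta> :: real
    and M :: nat
  assumes "MUBs \<B>" and "card \<B> = M" and "M \<ge> 1"
    and "\<alpha> \<in> {0<..2}" and "\<eta> \<in> {0..1}"
    and "density_matrix \<rho>"
  shows "1 / real M * (\<Sum>b\<in>\<B>. inefficient_entropy \<alpha> \<eta> b \<rho>)
    \<ge> \<eta> powr \<alpha> * ln_tsallis \<alpha>
          (real M * real CARD('d) / (Re (trace (\<rho> ** \<rho>)) * real CARD('d) + real M - 1))
      + binary_tsallis_entropy \<alpha> \<eta>"
proof -
  define d where "d = real CARD('d)"
  define p where "p b j = Re (cinner (b j) (\<rho> *v b j))" for b and j :: 'd
  define T where "T = Re (trace (\<rho> ** \<rho>))"
  \<comment> \<open>The upper bound on the index of coincidence averaged over the bases; its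
    reciprocal is the argument of the logarithm in the claim.\<close>
  define c where "c = (T + (real M - 1) / d) / real M"
  define L where "L = ln_tsallis \<alpha> (1 / c)"
  have d: "d > 0" by (simp add: d_def)
  \<comment> \<open>An infinite set has \<open>card\<close> equal to 0, which M \<ge> 1
    excludes.\<close>
  have fin: "finite \<B>" using assms(2,3) card.infinite by fastforce
  have herm: "hermitian \<rho>" and psd: "\<And>x. 0 \<le> Re (cinner x (\<rho> *v x))" and tr: "trace \<rho> = 1"
    using assms(6) by (auto simp: density_matrix_def positive_semidefinite_def)
  \<comment> \<open>The purity \<open>T\<close> is the squared Hilbert-Schmidt norm of \<rho>, hence
    positive.\<close>
  have "\<rho> \<noteq> 0" using tr by (auto simp: trace_def)
  then have "T > 0" using hermitian_inner_self[OF herm] by (metis T_def inner_gt_zero_iff)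
  then have c: "c > 0" using assms(3) d by (simp add: c_def add_pos_nonneg)
  have p0: "p b j \<ge> 0" for b j by (simp add: p_def psd)
  have p1: "sum (p b) UNIV = 1" if "b \<in> \<B>" for b
    using orthonormal_basis_sum_diagonal[of b \<rho>] assms(1) that tr by (simp add: p_def MUBs_def)
  have entropy: "inefficient_entropy \<alpha> \<eta> b \<rho>
      = \<eta> powr \<alpha> * tsallis_entropy \<alpha> (p b) + binary_tsallis_entropy \<alpha> \<eta>" if "b \<in> \<B>" for b
  proof -
    have "detection_distribution \<eta> b \<rho> = case_option (1 - \<eta>) (\<lambda>j. \<eta> * p b j)"
      by (simp add: fun_eq_iff detection_distribution_def p_def)
    then show ?thesis
      using tsallis_entropy_inefficient[OF p0 p1[OF that]] assms(5)
      by (simp add: inefficient_entropy_def)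
  qed
  \<comment> \<open>The added term is nonnegative because \<open>real M * c\<close> bounds the total
    of all squared probabilities. Individual bases may exceed \<open>c\<close>; with a common
    tangent only the total matters.\<close>
  have "real M * L
      \<le> real M * L + c powr (\<alpha> - 2) * (real M * c - (\<Sum>b\<in>\<B>. \<Sum>j\<in>UNIV. (p b j)\<^sup>2))"
    using MUBs_sum_diagonal_squares_le[OF assms(1) fin herm tr] assms(2,3)
    by (simp add: p_def c_def T_def d_def)
  also have "\<dots> = (\<Sum>b\<in>\<B>. L + c powr (\<alpha> - 2) * (c - (\<Sum>j\<in>UNIV. (p b j)\<^sup>2)))"
    using assms(2) by (simp add: sum.distrib sum_subtractf flip: sum_distrib_left)
  also have "\<dots> \<le> (\<Sum>b\<in>\<B>. tsallis_entropy \<alpha> (p b))"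
    unfolding L_def using assms(4) c p0 p1 by (intro sum_mono tsallis_entropy_ge) auto
  finally have "L \<le> 1 / real M * (\<Sum>b\<in>\<B>. tsallis_entropy \<alpha> (p b))"
    using assms(3) by (simp add: field_simps)
  then have "\<eta> powr \<alpha> * L \<le> \<eta> powr \<alpha> * (1 / real M * (\<Sum>b\<in>\<B>. tsallis_entropy \<alpha> (p b)))"
    by (intro mult_left_mono) auto
  moreover have "(\<Sum>b\<in>\<B>. inefficient_entropy \<alpha> \<eta> b \<rho>)
      = \<eta> powr \<alpha> * (\<Sum>b\<in>\<B>. tsallis_entropy \<alpha> (p b)) + real M * binary_tsallis_entropy \<alpha> \<eta>"
    using assms(2) by (simp add: entropy sum.distrib sum_distrib_left)
  ultimately have "\<eta> powr \<alpha> * L + binary_tsallis_entropy \<alpha> \<eta>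
      \<le> 1 / real M * (\<Sum>b\<in>\<B>. inefficient_entropy \<alpha> \<eta> b \<rho>)"
    using assms(3) by (simp add: add_divide_distrib)
  moreover have "1 / c = real M * d / (T * d + real M - 1)"
    using d by (simp add: c_def field_simps)
  ultimately show ?thesis by (simp add: L_def T_def d_def)
qed

end
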